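(* Let $\mathcal{T}$ be the set of admissible term structures, i.e. of smooth functions $T\mapsto P_{0T}$ on $[0,\infty)$ with $P_{00}=1$, $0<P_{0T}\le 1$ and $\frac{\partial}{\partial T}P_{0T}<0$ for all $T\ge 0$, and $P_{0T}\to 0$ as $T\to\infty$. Let $\mathcal{D}(\mathbf{R}^1_+)$ be the convex set of smooth density functions on the positive real line, i.e. of smooth functions $\rho:[0,\infty)\to(0,\infty)$ with $\int_0^\infty\rho(T)\,\mathrm{d}T=1$. Then $\mathcal{T}$ is isomorphic to the convex space $\mathcal{D}(\mathbf{R}^1_+)$ via $$P_{0T}\longmapsto \rho(T)=-\frac{\partial}{\partial T}P_{0T};$$ that is, this map is a bijection $\mathcal{T}\to\mathcal{D}(\mathbf{R}^1_+)$ which respects convex combinations: if $P^{1}_{0T},P^{2}_{0T}\in\mathcal{T}$ correspond to $\rho_1,\rho_2$ and $A,B\ge 0$ satisfy $A+B=1$, then $AP^{1}_{0T}+BP^{2}_{0T}\in\mathcal{T}$ corresponds to $A\rho_1+B\rho_2\in\mathcal{D}(\mathbf{R}^1_+)$.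
   Context: $P_{0T}$ is the value at time $0$ of a discount bond paying one unit at the maturity date $T$, $0\le T<\infty$. "Smooth" means infinitely differentiable (one-sided at $0$). *)

theory Defs
  imports "HOL-Analysis.Analysis"
begin

text \<open>
  Functions on the half-line \<open>[0, \<infinity>)\<close> are represented by elements of \<open>extensional {0..}\<close>, so
  that two of them are equal as soon as they agree on \<open>{0..}\<close>. This is what makes injectivity
  of maps between spaces of such functions meaningful.
\<close>

definition deriv_within :: "real set \<Rightarrow> (real \<Rightarrow> real) \<Rightarrow> real \<Rightarrow> real" where
  "deriv_within S f = (\<lambda>x. vector_derivative f (at x within S))"

text \<open>
  Only values at points of \<open>S\<close> matter below: the filter \<open>at x within S\<close> does not see any other
  values. For \<open>S = {0..}\<close> all derivatives at \<open>0\<close> are right-sided.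
\<close>

definition smooth_on :: "real set \<Rightarrow> (real \<Rightarrow> real) \<Rightarrow> bool" where
  "smooth_on S f \<longleftrightarrow>
     (\<forall>n. \<forall>x\<in>S. (deriv_within S ^^ n) f differentiable (at x within S))"

definition admissible_term_structures :: "(real \<Rightarrow> real) set" where
  "admissible_term_structures =
     {P \<in> extensional {0..}.
        smooth_on {0..} P \<and>
        P 0 = 1 \<and>
        (\<forall>T\<ge>0. 0 < P T \<and> P T \<le> 1) \<and>
        (\<forall>T\<ge>0. deriv_within {0..} P T < 0) \<and>
        (P \<longlongrightarrow> 0) at_top}"

definition smooth_densities :: "(real \<Rightarrow> real) set" where
  "smooth_densities =
     {\<rho> \<in> extensional {0..}.
        smooth_on {0..} \<rho> \<and>
        (\<forall>T\<ge>0. 0 < \<rho> T) \<and>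
        (\<rho> has_integral 1) {0..}}"

definition term_density :: "(real \<Rightarrow> real) \<Rightarrow> real \<Rightarrow> real" where
  "term_density P = restrict (\<lambda>T. - deriv_within {0..} P T) {0..}"

definition mixture :: "real \<Rightarrow> (real \<Rightarrow> real) \<Rightarrow> real \<Rightarrow> (real \<Rightarrow> real) \<Rightarrow> real \<Rightarrow> real" where
  "mixture A f B g = restrict (\<lambda>T. A * f T + B * g T) {0..}"

end

theory Submission
  imports Defs
begin

text \<open>
  Both directions are the fundamental theorem of calculus on \<open>[0, \<infinity>)\<close>: integrating
  \<open>\<rho> = - P'\<close> over \<open>[0, T]\<close> gives \<open>1 - P T\<close>, which tends to \<open>1\<close>, and the inverse map sends
  \<open>\<rho>\<close> to \<open>P T = 1 - (\<integral> x \<in> [0, T]. \<rho> x)\<close>. Compatibility with mixtures is linearity of the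
  derivative.
\<close>

subsection \<open>Derivatives relative to a set\<close>

text \<open>The filter \<open>at x within S\<close> sees only points of \<open>S\<close>, and the
  difference quotient also uses the value at \<open>x\<close>, whence \<open>x \<in> S\<close>. This
  lets functions built with \<open>restrict\<close> be exchanged for their plain formulas.\<close>

lemma has_vector_derivative_cong_on:
  assumes "x \<in> S" "\<And>y. y \<in> S \<Longrightarrow> f y = g y"
  shows "(f has_vector_derivative d) (at x within S) \<longleftrightarrow>
    (g has_vector_derivative d) (at x within S)"
  using assms by (metis has_vector_derivative_transform)

lemma deriv_within_cong:
  assumes "x \<in> S" "\<And>y. y \<in> S \<Longrightarrow> f y = g y"
  shows "deriv_within S f x = deriv_within S g x"
  unfolding deriv_within_def vector_derivative_def
  using has_vector_derivative_cong_on[OF assms] by simp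

lemma deriv_within_eqI:
  assumes "at x within S \<noteq> bot" "(f has_vector_derivative d) (at x within S)"
  shows "deriv_within S f x = d"
  unfolding deriv_within_def by (rule vector_derivative_within[OF assms])

lemma deriv_within_funpow_cong:
  assumes "x \<in> S" "\<And>y. y \<in> S \<Longrightarrow> f y = g y"
  shows "(deriv_within S ^^ n) f x = (deriv_within S ^^ n) g x"
  using assms(1)
proof (induction n arbitrary: x)
  case 0
  then show ?case using assms(2) by simp
next
  case (Suc n)
  then show ?case by (auto intro: deriv_within_cong)
qed

lemma differentiable_cong_on:
  assumes "x \<in> S" "\<And>y. y \<in> S \<Longrightarrow> f y = g y"
  shows "f differentiable (at x within S) \<longleftrightarrow> g differentiable (at x within S)"
  unfolding differentiable_def using assms by (metis has_derivative_transform)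

lemma smooth_on_cong:
  assumes "\<And>y. y \<in> S \<Longrightarrow> f y = g y"
  shows "smooth_on S f \<longleftrightarrow> smooth_on S g"
proof -
  have "(deriv_within S ^^ n) f differentiable (at x within S) \<longleftrightarrow>
      (deriv_within S ^^ n) g differentiable (at x within S)" if "x \<in> S" for n x
    using that by (intro differentiable_cong_on deriv_within_funpow_cong assms)
  then show ?thesis by (simp add: smooth_on_def)
qed

text \<open>Order 0 is split off and the orders \<open>Suc n\<close> are read as order
  \<open>n\<close> of the first derivative. Smoothness thus passes from \<open>P\<close> to its
  density and back.\<close>

lemma smooth_on_iff_deriv_within:
  "smooth_on S f \<longleftrightarrow>
    (\<forall>x\<in>S. f differentiable (at x within S)) \<and> smooth_on S (deriv_within S f)"
proof -
  have "smooth_on S f \<longleftrightarrow>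
      (\<forall>x\<in>S. (deriv_within S ^^ 0) f differentiable (at x within S)) \<and>
      (\<forall>n. \<forall>x\<in>S. (deriv_within S ^^ Suc n) f differentiable (at x within S))"
    unfolding smooth_on_def by (metis not0_implies_Suc)
  then show ?thesis by (simp only: smooth_on_def funpow_Suc_right o_apply funpow_0)
qed

lemma smooth_on_has_vector_derivative:
  assumes "smooth_on S f" "x \<in> S"
  shows "(f has_vector_derivative deriv_within S f x) (at x within S)"
  using assms smooth_on_iff_deriv_within[of S f]
  by (simp add: deriv_within_def flip: vector_derivative_works)

lemma smooth_on_imp_continuous_on: "smooth_on S f \<Longrightarrow> continuous_on S f"
  using smooth_on_has_vector_derivative continuous_on_vector_derivative by blast

lemma has_vector_derivative_linear_combination:
  fixes f g :: "real \<Rightarrow> real"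
  assumes "(f has_vector_derivative f') F" "(g has_vector_derivative g') F"
  shows "((\<lambda>y. a * f y + b * g y) has_vector_derivative a * f' + b * g') F"
  using assms has_vector_derivative_add
    bounded_linear.has_vector_derivative[OF bounded_linear_mult_right] by blast

text \<open>Smoothness makes every iterated derivative a genuine one rather than an arbitrary
  choice, and nontriviality of the filter makes it unique, so linearity carries over order by
  order.\<close>

lemma deriv_within_funpow_linear_combination:
  assumes S: "\<And>x. x \<in> S \<Longrightarrow> at x within S \<noteq> bot"
    and f: "smooth_on S f" and g: "smooth_on S g" and x: "x \<in> S"
  shows "(deriv_within S ^^ n) (\<lambda>y. a * f y + b * g y) x =
    a * (deriv_within S ^^ n) f x + b * (deriv_within S ^^ n) g x"
  using x
proof (induction n arbitrary: x)
  case (Suc n)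
  have "((deriv_within S ^^ n) h has_vector_derivative (deriv_within S ^^ Suc n) h x)
      (at x within S)" if "smooth_on S h" for h
    using that Suc.prems
    by (simp add: smooth_on_def deriv_within_def flip: vector_derivative_works)
  then have "((\<lambda>y. a * (deriv_within S ^^ n) f y + b * (deriv_within S ^^ n) g y)
      has_vector_derivative
        a * (deriv_within S ^^ Suc n) f x + b * (deriv_within S ^^ Suc n) g x)
      (at x within S)"
    using f g by (intro has_vector_derivative_linear_combination)
  then have "deriv_within S (\<lambda>y. a * (deriv_within S ^^ n) f y + b * (deriv_within S ^^ n) g y) x =
      a * (deriv_within S ^^ Suc n) f x + b * (deriv_within S ^^ Suc n) g x"
    using S[OF Suc.prems] by (rule deriv_within_eqI[rotated])
  \<comment> \<open>The induction hypothesis holds on all of \<open>S\<close>, so the outer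
    derivative may be taken of its right-hand side.\<close>
  then show ?case
    using deriv_within_cong[OF Suc.prems Suc.IH] by simp
qed simp

lemma smooth_on_linear_combination:
  assumes S: "\<And>x. x \<in> S \<Longrightarrow> at x within S \<noteq> bot"
    and f: "smooth_on S f" and g: "smooth_on S g"
  shows "smooth_on S (\<lambda>y. a * f y + b * g y)"
  unfolding smooth_on_def
proof (intro allI ballI)
  fix n x
  assume x: "x \<in> S"
  have "(\<lambda>y. a * (deriv_within S ^^ n) f y + b * (deriv_within S ^^ n) g y)
      differentiable (at x within S)"
    using f g x unfolding smooth_on_def
    by (intro differentiable_add differentiable_mult differentiable_const) auto
  then show "(deriv_within S ^^ n) (\<lambda>y. a * f y + b * g y) differentiable (at x within S)"
    by (subst differentiable_cong_on[OF x])
      (auto intro: deriv_within_funpow_linear_combination[OF S f g])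
qed

lemma smooth_on_uminus:
  assumes "\<And>x. x \<in> S \<Longrightarrow> at x within S \<noteq> bot" "smooth_on S f"
  shows "smooth_on S (\<lambda>x. - f x)"
  using smooth_on_linear_combination[OF assms(1,2,2), of "-1" 0] by simp

text \<open>A connected set with more than one point has no isolated points. This gives uniqueness
  of derivatives on the half-line, including the one-sided one at the endpoint.\<close>

lemma at_within_atLeast_neq_bot: "at x within {a..} \<noteq> bot" if "x \<in> {a..}" for x a :: real
proof -
  have "x islimpt {a..}"
    using that infinite_Ici[of a] by (intro connected_imp_perfect) (auto simp del: infinite_Ici)
  then show ?thesis by (simp add: trivial_limit_within)
qed

lemmas deriv_half_line_eqI = deriv_within_eqI[OF at_within_atLeast_neq_bot]

lemma decreasing_of_negative_deriv_within:
  assumes f: "smooth_on {a..} f" and neg: "\<And>x. x > a \<Longrightarrow> deriv_within {a..} f x < 0"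
    and "a \<le> x" "x < y"
  shows "f y < f x"
proof (rule DERIV_neg_imp_decreasing_open[OF \<open>x < y\<close>])
  show "continuous_on {x..y} f"
    using continuous_on_subset[OF smooth_on_imp_continuous_on[OF f]] assms by auto
next
  fix z
  assume z: "x < z" "z < y"
  \<comment> \<open>Interior points carry ordinary two-sided derivatives, and the mean value
    argument needs no others.\<close>
  then have "at z within {a..} = at z"
    using assms by (intro at_within_interior) simp
  then have "DERIV f z :> deriv_within {a..} f z"
    using smooth_on_has_vector_derivative[OF f, of z] z assms
    by (simp add: has_real_derivative_iff_has_vector_derivative)
  then show "\<exists>d. DERIV f z :> d \<and> d < 0"
    using neg[of z] z assms by auto
qed

subsection \<open>Integrals over a half-line\<close>

text \<open>By definition, an integral over an unbounded set is approximated on every box containing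
  a large enough ball; boxes ending at large \<open>y\<close> suffice.\<close>

lemma has_integral_half_line_tendsto:
  fixes f :: "real \<Rightarrow> 'b::banach"
  assumes "(f has_integral l) {a..}"
  shows "((\<lambda>y. integral {a..y} f) \<longlongrightarrow> l) at_top"
proof (rule tendstoI)
  fix e :: real
  assume "e > 0"
  then obtain B where B: "B > 0" "\<And>c d. ball 0 B \<subseteq> cbox c d \<Longrightarrow>
      norm (integral (cbox c d) (\<lambda>x. if x \<in> {a..} then f x else 0) - l) < e"
    using assms unfolding has_integral_alt'[of f] by metis
  have "dist (integral {a..y} f) l < e" if "y \<ge> max B a" for y
  proof -
    \<comment> \<open>The left end is at most \<open>- B\<close>, to cover the ball, and at most
      \<open>a\<close>, so that cutting with the half-line leaves exactly
      \<open>{a..y}\<close>.\<close>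
    have "ball 0 B \<subseteq> cbox (min (- B) a) y"
      using that by (auto simp: dist_real_def)
    then have "norm (integral {min (- B) a..y} (\<lambda>x. if x \<in> {a..} then f x else 0) - l) < e"
      using B(2) by fastforce
    moreover have "integral {min (- B) a..y} (\<lambda>x. if x \<in> {a..} then f x else 0) =
        integral ({min (- B) a..y} \<inter> {a..}) f"
      by (simp only: integral_restrict_Int Int_commute)
    moreover have "{min (- B) a..y} \<inter> {a..} = {a..y}"
      by auto
    ultimately show ?thesis by (simp add: dist_norm)
  qed
  then show "\<forall>\<^sub>F y in at_top. dist (integral {a..y} f) l < e"
    unfolding eventually_at_top_linorder by blast
qed

lemma integral_has_vector_derivative_half_line:
  fixes f :: "real \<Rightarrow> 'b::banach"
  assumes "continuous_on {a..} f" "x \<in> {a..}"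
  shows "((\<lambda>u. integral {a..u} f) has_vector_derivative f x) (at x within {a..})"
proof -
  \<comment> \<open>Ending the compact interval beyond \<open>x\<close> makes it agree with the
    half-line near \<open>x\<close>.\<close>
  have "((\<lambda>u. integral {a..u} f) has_vector_derivative f x) (at x within {a..x + 1})"
    using assms by (intro integral_has_vector_derivative continuous_on_subset[OF assms(1)]) auto
  moreover have "at x within {a..x + 1} = at x within {a..}"
    by (rule at_within_nhd[of _ "{..<x + 1}"]) auto
  ultimately show ?thesis by simp
qed

subsection \<open>Term structures and densities\<close>

lemma term_density_in_smooth_densities:
  assumes "P \<in> admissible_term_structures"
  shows "term_density P \<in> smooth_densities"
proof -
  have sm: "smooth_on {0..} P" and P0: "P 0 = 1"
    and neg: "\<And>T. T \<ge> 0 \<Longrightarrow> deriv_within {0..} P T < 0"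
    and lim: "(P \<longlongrightarrow> 0) at_top"
    using assms by (auto simp: admissible_term_structures_def)
  let ?\<rho> = "\<lambda>T. - deriv_within {0..} P T"
  have "smooth_on {0..} ?\<rho>"
    using sm smooth_on_iff_deriv_within smooth_on_uminus at_within_atLeast_neq_bot by blast
  then have smooth: "smooth_on {0..} (term_density P)"
    by (subst smooth_on_cong[where g = ?\<rho>]) (auto simp: term_density_def)
  have FTC: "(?\<rho> has_integral 1 - P y) {0..y}" if "y \<ge> 0" for y
  proof -
    have "(deriv_within {0..} P has_integral P y - P 0) {0..y}"
      using that
      by (intro fundamental_theorem_of_calculus has_vector_derivative_within_subset
          [OF smooth_on_has_vector_derivative[OF sm]]) auto
    then show ?thesis
      using has_integral_neg[of "deriv_within {0..} P" "P y - P 0"] by (simp add: P0)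
  qed
  \<comment> \<open>The integrand is nonnegative, so the limit of the masses \<open>1 - P y\<close>
    of \<open>{0..y}\<close> is the integral over the half-line.\<close>
  have "(?\<rho> has_integral 1) {0..}"
  proof (rule has_integral_to_inf)
    show "?\<rho> integrable_on {0..y}" for y
      using FTC[of y] by (cases "y \<ge> 0") auto
    have "((\<lambda>y. 1 - P y) \<longlongrightarrow> 1 - 0) at_top"
      by (intro tendsto_intros lim)
    moreover have "\<forall>\<^sub>F y in at_top. 1 - P y = integral {0..y} ?\<rho>"
      using eventually_ge_at_top[of 0]
      by eventually_elim (metis FTC integral_unique)
    ultimately show "((\<lambda>y. integral {0..y} ?\<rho>) \<longlongrightarrow> 1) at_top"
      using tendsto_cong by force
  qed (use neg in \<open>auto intro: less_imp_le\<close>)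
  then have "(term_density P has_integral 1) {0..}"
    by (rule has_integral_eq[rotated]) (simp add: term_density_def)
  then show ?thesis
    using smooth neg by (auto simp: smooth_densities_def term_density_def)
qed

text \<open>Equal densities make \<open>P - Q\<close> have derivative zero on a convex set, so it is
  constant, and its value at 0 is \<open>1 - 1\<close>. Extensionality then gives equality of the
  functions.\<close>

lemma inj_on_term_density: "inj_on term_density admissible_term_structures"
proof (rule inj_onI)
  fix P Q
  assume P: "P \<in> admissible_term_structures" and Q: "Q \<in> admissible_term_structures"
    and eq: "term_density P = term_density Q"
  have "((\<lambda>y. P y - Q y) has_derivative (\<lambda>h. 0)) (at x within {0..})" if x: "x \<in> {0..}" for x
  proof -
    have "deriv_within {0..} P x = deriv_within {0..} Q x"
      using fun_cong[OF eq, of x] x by (simp add: term_density_def)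
    then have "((\<lambda>y. P y - Q y) has_vector_derivative 0) (at x within {0..})"
      using has_vector_derivative_diff[OF smooth_on_has_vector_derivative[of "{0..}" P x]
          smooth_on_has_vector_derivative[of "{0..}" Q x]] P Q x
      by (simp add: admissible_term_structures_def)
    then show ?thesis by (simp add: has_vector_derivative_def)
  qed
  then obtain c where c: "\<And>x. x \<in> {0..} \<Longrightarrow> P x - Q x = c"
    using has_derivative_zero_constant[of "{0..}" "\<lambda>y. P y - Q y"] by auto
  moreover have "c = 0"
    using c[of 0] P Q by (simp add: admissible_term_structures_def)
  ultimately show "P = Q"
    using P Q by (intro extensionalityI[of P "{0..}" Q])
      (auto simp: admissible_term_structures_def)
qed

lemma smooth_density_in_term_density_image:
  assumes "\<rho> \<in> smooth_densities"
  shows "\<rho> \<in> term_density ` admissible_term_structures"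
proof -
  have ext: "\<rho> \<in> extensional {0..}" and sm: "smooth_on {0..} \<rho>"
    and pos: "\<And>T. T \<ge> 0 \<Longrightarrow> 0 < \<rho> T" and int: "(\<rho> has_integral 1) {0..}"
    using assms by (auto simp: smooth_densities_def)
  \<comment> \<open>The candidate is forced by the initial value 1 and the derivative
    \<open>- \<rho>\<close>.\<close>
  define P where "P = restrict (\<lambda>T. 1 - integral {0..T} \<rho>) {0..}"
  have der: "(P has_vector_derivative - \<rho> x) (at x within {0..})" if x: "x \<in> {0..}" for x
  proof -
    have "((\<lambda>T. 1 - integral {0..T} \<rho>) has_vector_derivative 0 - \<rho> x) (at x within {0..})"
      by (intro has_vector_derivative_diff has_vector_derivative_const
          integral_has_vector_derivative_half_line smooth_on_imp_continuous_on sm x)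
    then show ?thesis
      using has_vector_derivative_cong_on[OF x, of P "\<lambda>T. 1 - integral {0..T} \<rho>"]
      by (simp add: P_def)
  qed
  then have deriv: "deriv_within {0..} P x = - \<rho> x" if "x \<in> {0..}" for x
    using that by (intro deriv_half_line_eqI)
  \<comment> \<open>On the half-line the derivative is \<open>- \<rho>\<close>, so \<open>P\<close>
    inherits smoothness of every order from \<open>\<rho>\<close>.\<close>
  have "smooth_on {0..} (deriv_within {0..} P)"
    using smooth_on_uminus[OF at_within_atLeast_neq_bot sm]
    by (subst smooth_on_cong[where g = "\<lambda>x. - \<rho> x"]) (auto simp: deriv)
  then have smP: "smooth_on {0..} P"
    using der by (subst smooth_on_iff_deriv_within) (auto intro: differentiableI_vector)
  have P0: "P 0 = 1"
    by (simp add: P_def)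
  have decr: "P y < P x" if "0 \<le> x" "x < y" for x y
    using decreasing_of_negative_deriv_within[OF smP _ that] deriv pos by simp
  have "((\<lambda>T. 1 - integral {0..T} \<rho>) \<longlongrightarrow> 1 - 1) at_top"
    by (intro tendsto_intros has_integral_half_line_tendsto int)
  moreover have "\<forall>\<^sub>F T in at_top. 1 - integral {0..T} \<rho> = P T"
    using eventually_ge_at_top[of 0] by eventually_elim (simp add: P_def)
  ultimately have lim: "(P \<longlongrightarrow> 0) at_top"
    using tendsto_cong by force
  have "0 < P T" if T: "T \<ge> 0" for T
  proof -
    \<comment> \<open>The limit only yields a weak inequality; applying it at \<open>T + 1\<close>
      leaves room for strict decrease to give \<open>0 < P T\<close>.\<close>
    have "\<forall>\<^sub>F y in at_top. P y \<le> P (T + 1)"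
      using eventually_gt_at_top[of "T + 1"]
      by eventually_elim (use decr T in \<open>auto intro: less_imp_le\<close>)
    then have "0 \<le> P (T + 1)"
      using tendsto_upperbound[OF lim] by simp
    also have "\<dots> < P T"
      using T by (intro decr) auto
    finally show ?thesis .
  qed
  moreover have "P T \<le> 1" if "T \<ge> 0" for T
    using decr[of 0 T] that P0 by (cases "T = 0") auto
  ultimately have "P \<in> admissible_term_structures"
    using smP P0 lim pos deriv by (simp add: admissible_term_structures_def) (simp add: P_def)
  moreover have "\<rho> = term_density P"
    using deriv by (intro extensionalityI[OF ext]) (auto simp: term_density_def)
  ultimately show ?thesis by blast
qed

section \<open>Convex combinations\<close>

lemma deriv_within_mixture:
  assumes "smooth_on {0..} f" "smooth_on {0..} g" "x \<in> {0..}"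
  shows "deriv_within {0..} (mixture a f b g) x =
    a * deriv_within {0..} f x + b * deriv_within {0..} g x"
proof -
  have "deriv_within {0..} (mixture a f b g) x = deriv_within {0..} (\<lambda>y. a * f y + b * g y) x"
    using assms(3) by (intro deriv_within_cong) (auto simp: mixture_def)
  also have "\<dots> = a * deriv_within {0..} f x + b * deriv_within {0..} g x"
    using deriv_within_funpow_linear_combination[OF at_within_atLeast_neq_bot assms, of 1] by simp
  finally show ?thesis .
qed

lemma term_density_mixture:
  assumes "smooth_on {0..} P" "smooth_on {0..} Q"
  shows "term_density (mixture a P b Q) = mixture a (term_density P) b (term_density Q)"
proof
  fix x
  show "term_density (mixture a P b Q) x = mixture a (term_density P) b (term_density Q) x"
    \<comment> \<open>For negative \<open>x\<close> both sides are \<open>undefined\<close> by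
      \<open>restrict\<close>, so the equality holds for every real \<open>x\<close>.\<close>
    using deriv_within_mixture[OF assms, of x a b]
    by (simp add: term_density_def mixture_def)
qed

lemma mixture_in_admissible_term_structures:
  assumes P: "P \<in> admissible_term_structures" and Q: "Q \<in> admissible_term_structures"
    and ab: "0 \<le> a" "0 \<le> b" "a + b = 1"
  shows "mixture a P b Q \<in> admissible_term_structures"
proof -
  have sm: "smooth_on {0..} P" "smooth_on {0..} Q"
    using P Q by (auto simp: admissible_term_structures_def)
  have "smooth_on {0..} (\<lambda>y. a * P y + b * Q y)"
    using sm by (intro smooth_on_linear_combination at_within_atLeast_neq_bot)
  then have "smooth_on {0..} (mixture a P b Q)"
    by (subst smooth_on_cong[where g = "\<lambda>y. a * P y + b * Q y"]) (auto simp: mixture_def)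
  moreover have "mixture a P b Q 0 = 1"
    using P Q ab by (simp add: mixture_def admissible_term_structures_def)
  moreover have "0 < mixture a P b Q T \<and> mixture a P b Q T \<le> 1" if "T \<ge> 0" for T
  proof -
    have "P T \<le> 1" "Q T \<le> 1" "- P T < 0" "- Q T < 0"
      using P Q that by (auto simp: admissible_term_structures_def)
    \<comment> \<open>Positivity is an upper bound on \<open>- P T\<close> and \<open>- Q T\<close>;
      it stays strict because nonnegative weights with sum 1 cannot both vanish.\<close>
    then show ?thesis
      using convex_bound_lt[of "- P T" 0 "- Q T" a b] convex_bound_le[of "P T" 1 "Q T" a b] ab that
      by (simp add: mixture_def)
  qed
  moreover have "deriv_within {0..} (mixture a P b Q) T < 0" if "T \<ge> 0" for T
    using P Q that ab
    by (simp add: deriv_within_mixture[OF sm] convex_bound_lt admissible_term_structures_def)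
  moreover have "(mixture a P b Q \<longlongrightarrow> 0) at_top"
  proof -
    have "(P \<longlongrightarrow> 0) at_top" "(Q \<longlongrightarrow> 0) at_top"
      using P Q by (auto simp: admissible_term_structures_def)
    then have "((\<lambda>T. a * P T + b * Q T) \<longlongrightarrow> a * 0 + b * 0) at_top"
      by (intro tendsto_intros)
    moreover have "\<forall>\<^sub>F T in at_top. a * P T + b * Q T = mixture a P b Q T"
      using eventually_ge_at_top[of 0] by eventually_elim (simp add: mixture_def)
    ultimately show ?thesis
      using tendsto_cong by force
  qed
  ultimately show ?thesis
    by (simp add: admissible_term_structures_def) (simp add: mixture_def)
qed

theorem proposition1:
  shows "bij_betw term_density admissible_term_structures smooth_densities \<and>
    (\<forall>P1\<in>admissible_term_structures. \<forall>P2\<in>admissible_term_structures. \<forall>A B :: real.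
       0 \<le> A \<and> 0 \<le> B \<and> A + B = 1 \<longrightarrow>
         mixture A P1 B P2 \<in> admissible_term_structures \<and>
         mixture A (term_density P1) B (term_density P2) \<in> smooth_densities \<and>
         term_density (mixture A P1 B P2) =
           mixture A (term_density P1) B (term_density P2))"
proof (intro conjI ballI allI impI)
  show "bij_betw term_density admissible_term_structures smooth_densities"
    unfolding bij_betw_def
    using inj_on_term_density term_density_in_smooth_densities smooth_density_in_term_density_image
    by blast
next
  fix P1 P2 and A B :: real
  assume P: "P1 \<in> admissible_term_structures" "P2 \<in> admissible_term_structures"
    and AB: "0 \<le> A \<and> 0 \<le> B \<and> A + B = 1"
  show *: "mixture A P1 B P2 \<in> admissible_term_structures"
    using mixture_in_admissible_term_structures P AB by blast
  show **: "term_density (mixture A P1 B P2) = mixture A (term_density P1) B (term_density P2)"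
    using P by (intro term_density_mixture) (auto simp: admissible_term_structures_def)
  \<comment> \<open>The mixture of densities is itself the density of an admissible term structure,
    so its membership needs no separate integral computation.\<close>
  show "mixture A (term_density P1) B (term_density P2) \<in> smooth_densities"
    using term_density_in_smooth_densities[OF *] ** by simp
qed

end
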